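(* Let $\lambda>0$. Define $f:\mathbf{V}\to\mathbb{R}$ by $f(x)=\inf\{\beta(\xi):\xi\text{ cycle based on }x\}$, and $$U(x)=\inf\{\rho(f(\mathrm{o}(\xi)),\xi):\ \xi\text{ path with }\mathrm{t}(\xi)=x\},\qquad x\in\mathbf{V}.$$ Then $U$ is a solution of the discrete equation $$U(x)=\min_{e\in\mathbf{E},\ \mathrm{t}(e)=x}\rho\big(U(\mathrm{o}(e)),e\big)\qquad\text{for all }x\in\mathbf{V}.$$
   Context: Network: $\Gamma=\bigcup_{\gamma\in\mathcal{E}}\gamma([0,1])\subset\mathbb{R}^N$, where $\mathcal{E}$ is a finite collection of regular simple curves $\gamma:[0,1]\to\mathbb{R}^N$ (arcs; closed arcs with $\gamma(0)=\gamma(1)$, and several arcs joining the same points, are allowed). For each arc $\gamma$ the inverse arc $-\gamma$, $(-\gamma)(s)=\gamma(1-s)$, also belongs to $\mathcal{E}$ and is regarded as distinct from $\gamma$; and $\gamma((0,1))\cap\gamma'([0,1])=\emptyset$ whenever $\gamma\ne\pm\gamma'$. $\mathbf{V}$ is the (finite) set of vertices, i.e. of initial and terminal points of arcs. $\Gamma$ is connected: any two vertices are linked by a finite concatenation of arcs. Hamiltonians: for each $\gamma\in\mathcal{E}$, $H_\gamma:[0,1]\times\mathbb{R}\to\mathbb{R}$ is continuous in $(s,p)$, coercive in $p$ ($H_\gamma(s,p)\to+\infty$ as $|p|\to\infty$, uniformly in $s$), and $H_{-\gamma}(s,p)=H_\gamma(1-s,-p)$. No convexity is assumed. Equation on an arc: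 (E$_\gamma$) $\lambda w+H_\gamma(s,w')=0$ in $(0,1)$; subsolutions are continuous functions on $[0,1]$ that are viscosity subsolutions in $(0,1)$. Graph: $\mathbf{E}$ is an abstract set with a bijection $\Psi:\mathbf{E}\to\mathcal{E}$; for $e\in\mathbf{E}$ put $\mathrm{o}(e)=\Psi(e)(0)$, $-e=\Psi^{-1}(-\Psi(e))$, $\mathrm{t}(e)=\mathrm{o}(-e)=\Psi(e)(1)$. For $\alpha\in\mathbb{R}$ and $\gamma\in\mathcal{E}$ let $u_\alpha^\gamma(s)=\sup\{w(s): w$ subsolution of (E$_\gamma$) with $w(0)\le\alpha\}$, $s\in[0,1]$, and set $\rho(\alpha,e)=u_\alpha^{\Psi(e)}(1)$. Paths: a path is a finite sequence $\xi=(e_i)_{i=1}^M$, $M\ge1$, of edges with $\mathrm{t}(e_j)=\mathrm{o}(e_{j+1})$; $\mathrm{o}(\xi)=\mathrm{o}(e_1)$, $\mathrm{t}(\xi)=\mathrm{t}(e_M)$. It is a cycle, based on $\mathrm{o}(\xi)$, if $\mathrm{o}(\xi)=\mathrm{t}(\xi)$. The function $\rho$ is extended to paths inductively by $\rho(\alpha,(e_i)_{i=1}^M)=\rho\big(\rho(\alpha,(e_i)_{i=1}^{M-1}),e_M\big)$. For a cycle $\xi$, $\beta(\xi)$ denotes the unique $\alpha\in\mathbb{R}$ with $\rho(\alpha,\xi)=\alpha$ (existence and uniqueness are known). *)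

theory Defs
  imports "HOL-Analysis.Analysis"
begin

section \<open>Networks\<close>

text \<open>Curves are total functions on the reals of which only the values on \<open>[0,1]\<close> matter; the
  inverse arc is \<open>reversepath\<close>. Regularity means \<open>C\<^sup>1\<close> up to the end points (one-sided derivatives
  there) with nowhere vanishing velocity, and \<open>simple_path\<close> allows closed arcs.\<close>

definition regular_curve :: "(real \<Rightarrow> real ^ 'n) \<Rightarrow> bool" where
  "regular_curve \<gamma> \<longleftrightarrow>
     (\<exists>D. continuous_on {0..1} D \<and>
          (\<forall>s\<in>{0..1}. (\<gamma> has_vector_derivative D s) (at s within {0..1}) \<and> D s \<noteq> 0))"

definition vertices :: "(real \<Rightarrow> real ^ 'n) set \<Rightarrow> (real ^ 'n) set" where
  "vertices \<A> = pathstart ` \<A> \<union> pathfinish ` \<A>"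

text \<open>An arc is automatically distinct from its inverse, because it is simple. Two elements of
  \<open>\<A>\<close> that agree on \<open>[0,1]\<close> but differ outside are excluded by the disjointness condition.\<close>

definition network :: "(real \<Rightarrow> real ^ 'n) set \<Rightarrow> bool" where
  "network \<A> \<longleftrightarrow>
     finite \<A> \<and>
     (\<forall>\<gamma>\<in>\<A>. regular_curve \<gamma> \<and> simple_path \<gamma> \<and> reversepath \<gamma> \<in> \<A>) \<and>
     (\<forall>\<gamma>\<in>\<A>. \<forall>\<gamma>'\<in>\<A>. \<gamma> \<noteq> \<gamma>' \<and> \<gamma> \<noteq> reversepath \<gamma>' \<longrightarrow> \<gamma> ` {0<..<1} \<inter> \<gamma>' ` {0..1} = {}) \<and>
     (\<forall>x\<in>vertices \<A>. \<forall>y\<in>vertices \<A>. \<exists>\<gamma>s. \<gamma>s \<noteq> [] \<and> set \<gamma>s \<subseteq> \<A> \<and>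
        successively (\<lambda>\<gamma> \<gamma>'. pathfinish \<gamma> = pathstart \<gamma>') \<gamma>s \<and>
        pathstart (hd \<gamma>s) = x \<and> pathfinish (last \<gamma>s) = y)"

section \<open>Hamiltonians and subsolutions on an arc\<close>

definition coercive :: "(real \<Rightarrow> real \<Rightarrow> real) \<Rightarrow> bool" where
  "coercive h \<longleftrightarrow> (\<forall>C. \<exists>R. \<forall>s\<in>{0..1}. \<forall>p. R \<le> \<bar>p\<bar> \<longrightarrow> C \<le> h s p)"

definition hamiltonians ::
    "(real \<Rightarrow> real ^ 'n) set \<Rightarrow> ((real \<Rightarrow> real ^ 'n) \<Rightarrow> real \<Rightarrow> real \<Rightarrow> real) \<Rightarrow> bool" where
  "hamiltonians \<A> H \<longleftrightarrow>
     (\<forall>\<gamma>\<in>\<A>. continuous_on ({0..1} \<times> UNIV) (\<lambda>(s, p). H \<gamma> s p) \<and> coercive (H \<gamma>) \<and>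
        (\<forall>s\<in>{0..1}. \<forall>p. H (reversepath \<gamma>) s p = H \<gamma> (1 - s) (- p)))"

text \<open>Viscosity subsolutions of \<open>lam w + h(s, w') = 0\<close> in \<open>(0,1)\<close>, continuous on \<open>[0,1]\<close>: the test
  functions \<open>\<phi>\<close> are \<open>C\<^sup>1\<close> with derivative \<open>\<phi>'\<close>, and touch \<open>w\<close> from above at \<open>s\<close> up to a constant.\<close>

definition subsolution :: "real \<Rightarrow> (real \<Rightarrow> real \<Rightarrow> real) \<Rightarrow> (real \<Rightarrow> real) \<Rightarrow> bool" where
  "subsolution lam h w \<longleftrightarrow>
     continuous_on {0..1} w \<and>
     (\<forall>\<phi> \<phi>' s. s \<in> {0<..<1} \<longrightarrow>
        (\<forall>t\<in>{0<..<1}. (\<phi> has_real_derivative \<phi>' t) (at t)) \<longrightarrow>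
        continuous_on {0<..<1} \<phi>' \<longrightarrow>
        (\<forall>\<^sub>F t in at s. w t - \<phi> t \<le> w s - \<phi> s) \<longrightarrow>
        lam * w s + h s (\<phi>' s) \<le> 0)"

text \<open>For \<open>lam > 0\<close> and continuous coercive \<open>h\<close> the set below is nonempty and bounded above: constants
  that are sufficiently negative are subsolutions, and every subsolution is at most
  \<open>- (min h) / lam\<close>.\<close>

definition max_subsol :: "real \<Rightarrow> (real \<Rightarrow> real \<Rightarrow> real) \<Rightarrow> real \<Rightarrow> real \<Rightarrow> real" where
  "max_subsol lam h \<alpha> s = Sup {w s |w. subsolution lam h w \<and> w 0 \<le> \<alpha>}"

section \<open>The abstract graph\<close>

text \<open>\<open>E\<close> is the edge set and \<open>\<Psi>\<close> the bijection from \<open>E\<close> onto the set of arcs.\<close>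

definition orig :: "('e \<Rightarrow> real \<Rightarrow> real ^ 'n) \<Rightarrow> 'e \<Rightarrow> real ^ 'n" where
  "orig \<Psi> e = \<Psi> e 0"

definition inv_edge :: "'e set \<Rightarrow> ('e \<Rightarrow> real \<Rightarrow> real ^ 'n) \<Rightarrow> 'e \<Rightarrow> 'e" where
  "inv_edge E \<Psi> e = inv_into E \<Psi> (reversepath (\<Psi> e))"

definition terminal :: "'e set \<Rightarrow> ('e \<Rightarrow> real \<Rightarrow> real ^ 'n) \<Rightarrow> 'e \<Rightarrow> real ^ 'n" where
  "terminal E \<Psi> e = orig \<Psi> (inv_edge E \<Psi> e)"

lemma terminal_eq:
  assumes "network \<A>" "bij_betw \<Psi> E \<A>" "e \<in> E"
  shows "terminal E \<Psi> e = \<Psi> e 1"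
proof -
  have "reversepath (\<Psi> e) \<in> \<Psi> ` E"
    using assms by (auto simp: network_def bij_betw_def)
  then show ?thesis
    by (simp add: terminal_def orig_def inv_edge_def f_inv_into_f reversepath_def)
qed

definition rho ::
    "real \<Rightarrow> ((real \<Rightarrow> real ^ 'n) \<Rightarrow> real \<Rightarrow> real \<Rightarrow> real) \<Rightarrow> ('e \<Rightarrow> real \<Rightarrow> real ^ 'n) \<Rightarrow>
     real \<Rightarrow> 'e \<Rightarrow> real" where
  "rho lam H \<Psi> \<alpha> e = max_subsol lam (H (\<Psi> e)) \<alpha> 1"

definition is_path :: "'e set \<Rightarrow> ('e \<Rightarrow> real \<Rightarrow> real ^ 'n) \<Rightarrow> 'e list \<Rightarrow> bool" where
  "is_path E \<Psi> \<xi> \<longleftrightarrow>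
     \<xi> \<noteq> [] \<and> set \<xi> \<subseteq> E \<and> successively (\<lambda>e e'. terminal E \<Psi> e = orig \<Psi> e') \<xi>"

definition path_orig :: "('e \<Rightarrow> real \<Rightarrow> real ^ 'n) \<Rightarrow> 'e list \<Rightarrow> real ^ 'n" where
  "path_orig \<Psi> \<xi> = orig \<Psi> (hd \<xi>)"

definition path_term :: "'e set \<Rightarrow> ('e \<Rightarrow> real \<Rightarrow> real ^ 'n) \<Rightarrow> 'e list \<Rightarrow> real ^ 'n" where
  "path_term E \<Psi> \<xi> = terminal E \<Psi> (last \<xi>)"

definition is_cycle :: "'e set \<Rightarrow> ('e \<Rightarrow> real \<Rightarrow> real ^ 'n) \<Rightarrow> 'e list \<Rightarrow> bool" where
  "is_cycle E \<Psi> \<xi> \<longleftrightarrow> is_path E \<Psi> \<xi> \<and> path_orig \<Psi> \<xi> = path_term E \<Psi> \<xi>"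

definition rho_path ::
    "real \<Rightarrow> ((real \<Rightarrow> real ^ 'n) \<Rightarrow> real \<Rightarrow> real \<Rightarrow> real) \<Rightarrow> ('e \<Rightarrow> real \<Rightarrow> real ^ 'n) \<Rightarrow>
     real \<Rightarrow> 'e list \<Rightarrow> real" where
  "rho_path lam H \<Psi> \<alpha> \<xi> = foldl (rho lam H \<Psi>) \<alpha> \<xi>"

lemma rho_path_singleton: "rho_path lam H \<Psi> \<alpha> [e] = rho lam H \<Psi> \<alpha> e"
  and rho_path_snoc: "rho_path lam H \<Psi> \<alpha> (\<xi> @ [e]) = rho lam H \<Psi> (rho_path lam H \<Psi> \<alpha> \<xi>) e"
  by (simp_all add: rho_path_def)

text \<open>The fixed point is meaningful for cycles, where it exists and is unique.\<close>

definition beta ::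
    "real \<Rightarrow> ((real \<Rightarrow> real ^ 'n) \<Rightarrow> real \<Rightarrow> real \<Rightarrow> real) \<Rightarrow> ('e \<Rightarrow> real \<Rightarrow> real ^ 'n) \<Rightarrow>
     'e list \<Rightarrow> real" where
  "beta lam H \<Psi> \<xi> = (THE \<alpha>. rho_path lam H \<Psi> \<alpha> \<xi> = \<alpha>)"

text \<open>The infima below are over nonempty sets that are bounded below, for vertices \<open>x\<close> of a network
  and \<open>lam > 0\<close>: a constant that is a subsolution on every arc is a lower bound.\<close>

definition cycle_inf ::
    "real \<Rightarrow> ((real \<Rightarrow> real ^ 'n) \<Rightarrow> real \<Rightarrow> real \<Rightarrow> real) \<Rightarrow> 'e set \<Rightarrow>
     ('e \<Rightarrow> real \<Rightarrow> real ^ 'n) \<Rightarrow> real ^ 'n \<Rightarrow> real" where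
  "cycle_inf lam H E \<Psi> x = Inf {beta lam H \<Psi> \<xi> |\<xi>. is_cycle E \<Psi> \<xi> \<and> path_orig \<Psi> \<xi> = x}"

definition path_inf ::
    "real \<Rightarrow> ((real \<Rightarrow> real ^ 'n) \<Rightarrow> real \<Rightarrow> real \<Rightarrow> real) \<Rightarrow> 'e set \<Rightarrow>
     ('e \<Rightarrow> real \<Rightarrow> real ^ 'n) \<Rightarrow> (real ^ 'n \<Rightarrow> real) \<Rightarrow> real ^ 'n \<Rightarrow> real" where
  "path_inf lam H E \<Psi> f x =
     Inf {rho_path lam H \<Psi> (f (path_orig \<Psi> \<xi>)) \<xi> |\<xi>. is_path E \<Psi> \<xi> \<and> path_term E \<Psi> \<xi> = x}"

end

theory Submission
  imports Defs
begin

text \<open>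
  The equation is dynamic programming for \<open>U\<close>: a path ending at \<open>x\<close> is either a path ending at
  \<open>orig \<Psi> e\<close> prolonged by its last edge \<open>e\<close>, or the single edge \<open>e\<close>. What makes this work are three
  properties of \<open>\<rho>\<close>.

  \<^item> \<open>\<rho>(\<cdot>, e)\<close> is nondecreasing and increases strictly slower than the identity
    (\<open>discounted_arc.max_subsol_end\<close>). Subtracting a constant \<open>\<delta> > 0\<close> from a subsolution leaves a gap
    of \<open>\<lambda>\<delta>\<close> in the equation. This gives the bound with slope one, and since coercivity confines the
    relevant slopes to a compact set, the gap can be spent on tilting all the relevant subsolutions
    upwards by the same small slope, which makes the bound strict. Both properties pass to
    \<open>\<rho>(\<cdot>, \<xi>)\<close> for paths \<open>\<xi>\<close>.
  \<^item> \<open>c \<le> \<rho>(c, e)\<close> for very negative \<open>c\<close>, because such constants are subsolutions.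
  \<^item> \<open>\<rho>(\<cdot>, e)\<close> is bounded above, because every subsolution is at most \<open>- (inf h) / \<lambda>\<close>.

  Together they give existence and uniqueness of the fixed point \<open>\<beta>(\<xi>)\<close> and a common lower bound \<open>c\<close>
  of all the quantities over which infima are taken.

  A path \<open>\<xi>\<close> to \<open>orig \<Psi> e\<close> can be prolonged by \<open>e\<close>, and the slope bound lets \<open>\<rho>(\<cdot>, e)\<close> be exchanged
  with the infimum over \<open>\<xi>\<close>; hence \<open>U(x) \<le> \<rho>(U(orig e), e)\<close>. Conversely, removing the last edge of
  a path of length at least two and using monotonicity shows that some \<open>\<rho>(U(orig e), e)\<close> lies below
  its value. For a path consisting of \<open>e\<close> only, the same works provided that \<open>U \<le> f\<close>, and this is
  the role of the cycles: for a cycle \<open>\<xi>\<close> based on \<open>y\<close>,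
  \<open>\<beta>(\<xi>) = \<rho>(\<beta>(\<xi>), \<xi>) \<ge> \<rho>(f(y), \<xi>) \<ge> U(y)\<close>, as the cycle is itself a path ending at \<open>y\<close>.
\<close>

section \<open>Subsolutions on an arc\<close>

lemma subsolutionD:
  assumes "subsolution lam h w" "s \<in> {0<..<1}"
    and "\<And>t. t \<in> {0<..<1} \<Longrightarrow> (\<phi> has_real_derivative \<phi>' t) (at t)"
    and "continuous_on {0<..<1} \<phi>'"
    and "\<forall>\<^sub>F t in at s. w t - \<phi> t \<le> w s - \<phi> s"
  shows "lam * w s + h s (\<phi>' s) \<le> 0"
  using assms unfolding subsolution_def by blast

lemma subsolution_const:
  assumes "\<And>s. s \<in> {0..1} \<Longrightarrow> lam * c + h s 0 \<le> 0"
  shows "subsolution lam h (\<lambda>_. c)"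
  unfolding subsolution_def
proof (intro conjI allI impI)
  fix \<phi> \<phi>' :: "real \<Rightarrow> real" and s :: real
  assume s: "s \<in> {0<..<1}"
    and d: "\<forall>t\<in>{0<..<1}. (\<phi> has_real_derivative \<phi>' t) (at t)"
    and max: "\<forall>\<^sub>F t in at s. c - \<phi> t \<le> c - \<phi> s"
  obtain r where "r > 0" "\<forall>t. t \<noteq> s \<and> dist t s < r \<longrightarrow> \<phi> s \<le> \<phi> t"
    using max unfolding eventually_at by auto
  then have "\<forall>y. \<bar>s - y\<bar> < r \<longrightarrow> \<phi> s \<le> \<phi> y"
    by (metis dist_real_def abs_minus_commute order_refl)
  then have "\<phi>' s = 0"
    using DERIV_local_min[of \<phi> "\<phi>' s" s r] d s \<open>r > 0\<close> by auto
  then show "lam * c + h s (\<phi>' s) \<le> 0"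
    using assms s by auto
qed simp

lemma subsolution_max:
  assumes v: "subsolution lam h v" and w: "subsolution lam h w"
  shows "subsolution lam h (\<lambda>s. max (v s) (w s))"
  unfolding subsolution_def
proof (intro conjI allI impI)
  show "continuous_on {0..1} (\<lambda>s. max (v s) (w s))"
    using v w by (auto simp: subsolution_def intro: continuous_on_max)
next
  fix \<phi> \<phi>' :: "real \<Rightarrow> real" and s :: real
  assume s: "s \<in> {0<..<1}"
    and d: "\<forall>t\<in>{0<..<1}. (\<phi> has_real_derivative \<phi>' t) (at t)" "continuous_on {0<..<1} \<phi>'"
    and max: "\<forall>\<^sub>F t in at s. max (v t) (w t) - \<phi> t \<le> max (v s) (w s) - \<phi> s"
  show "lam * max (v s) (w s) + h s (\<phi>' s) \<le> 0"
  proof (cases "w s \<le> v s")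
    case True
    have "\<forall>\<^sub>F t in at s. v t - \<phi> t \<le> v s - \<phi> s"
      using max by eventually_elim (use True in auto)
    from subsolutionD[OF v s _ d(2) this] d(1) show ?thesis
      using True by (simp add: max_def)
  next
    case False
    have "\<forall>\<^sub>F t in at s. w t - \<phi> t \<le> w s - \<phi> s"
      using max by eventually_elim (use False in auto)
    from subsolutionD[OF w s _ d(2) this] d(1) show ?thesis
      using False by (simp add: max_def)
  qed
qed

text \<open>A subsolution need not be touched from above by a \<open>C\<^sup>1\<close> function at a given interior point
  \<open>s\<close>. It is touched by a steep parabola centred at \<open>s\<close> at some point near \<open>s\<close> where its value is no
  smaller, and that suffices for the bound.\<close>

lemma subsolution_le:
  assumes "lam > 0" and w: "subsolution lam h w"
    and m: "\<And>s p. s \<in> {0..1} \<Longrightarrow> m \<le> h s p"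
    and s: "s \<in> {0..1}"
  shows "w s \<le> - m / lam"
proof -
  have cont: "continuous_on {0..1} w"
    using w by (simp add: subsolution_def)
  have inner: "w s \<le> - m / lam" if s: "s \<in> {0<..<1}" for s
  proof -
    obtain K where K: "\<And>t. t \<in> {0..1} \<Longrightarrow> \<bar>w t\<bar> \<le> K"
      using compact_imp_bounded[OF compact_continuous_image[OF cont compact_Icc]]
      by (fastforce simp: bounded_iff)
    define r where "r = min s (1 - s) / 2"
    have r: "r > 0" "0 < s - r" "s + r < 1"
      using s by (auto simp: r_def min_def field_simps)
    \<comment> \<open>The parabola exceeds the oscillation \<open>2 * K\<close> of \<open>w\<close> at distance \<open>r\<close> from \<open>s\<close>, so that the
      maximum of \<open>w - \<phi>\<close> is attained strictly inside.\<close>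
    define C where "C = (2 * K + 1) / r\<^sup>2"
    define \<phi> where "\<phi> t = C * (t - s)\<^sup>2" for t
    define \<phi>' where "\<phi>' t = C * (2 * (t - s))" for t
    have d: "(\<phi> has_real_derivative \<phi>' t) (at t)" for t
      unfolding \<phi>_def \<phi>'_def by (auto intro!: derivative_eq_intros)
    have K0: "0 \<le> K"
      using K[of 0] by auto
    have cont': "continuous_on {s-r..s+r} (\<lambda>t. w t - \<phi> t)"
      unfolding \<phi>_def using r
      by (intro continuous_intros continuous_on_subset[OF cont]) auto
    obtain z where z: "z \<in> {s-r..s+r}"
      and zmax: "\<And>t. t \<in> {s-r..s+r} \<Longrightarrow> w t - \<phi> t \<le> w z - \<phi> z"
      using continuous_attains_sup[OF compact_Icc _ cont'] r by auto
    have zs: "w s \<le> w z - \<phi> z"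
      using zmax[of s] r by (simp add: \<phi>_def)
    have edge: "w t - \<phi> t < w s" if "\<bar>t - s\<bar> = r" for t
    proof -
      have "(t - s)\<^sup>2 = r\<^sup>2"
        using that by (metis power2_abs)
      then have "\<phi> t = 2 * K + 1"
        using r by (simp add: \<phi>_def C_def)
      moreover have "\<bar>w t\<bar> \<le> K" "\<bar>w s\<bar> \<le> K"
        using that r s by (auto intro!: K)
      ultimately show ?thesis by linarith
    qed
    have "\<bar>z - s\<bar> \<noteq> r"
      using edge[of z] zs by auto
    then have zi: "z \<in> {s-r<..<s+r}"
      using z by auto
    then have "\<forall>\<^sub>F t in at z. t \<in> {s-r<..<s+r}"
      by (intro eventually_at_in_open') auto
    then have "\<forall>\<^sub>F t in at z. w t - \<phi> t \<le> w z - \<phi> z"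
      by eventually_elim (auto intro: zmax)
    moreover have "z \<in> {0<..<1}"
      using zi r by auto
    moreover have "continuous_on {0<..<1} \<phi>'"
      unfolding \<phi>'_def by (intro continuous_intros)
    ultimately have "lam * w z + h z (\<phi>' z) \<le> 0"
      using subsolutionD[OF w _ d] by blast
    then have "lam * w z + m \<le> 0"
      using m[of z "\<phi>' z"] \<open>z \<in> {0<..<1}\<close> by auto
    then have "w z \<le> - m / lam"
      using \<open>lam > 0\<close> by (simp add: field_simps)
    moreover have "\<phi> z \<ge> 0"
      using K0 by (simp add: \<phi>_def C_def)
    ultimately show ?thesis
      using zs by linarith
  qed
  have "closure {0<..<1::real} = {0..1}"
    by simp
  then show ?thesis
    using continuous_le_on_closure[of "{0<..<1}" w s "- m / lam"] cont s inner by simp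
qed

locale discounted_arc =
  fixes lam :: real and h :: "real \<Rightarrow> real \<Rightarrow> real"
  assumes lam_pos: "lam > 0"
    and cont: "continuous_on ({0..1} \<times> UNIV) (\<lambda>(s, p). h s p)"
    and coer: "coercive h"
begin

lemma bounded_below: "\<exists>m. \<forall>s\<in>{0..1}. \<forall>p. m \<le> h s p"
proof -
  obtain R where R: "\<And>s p. s \<in> {0..1} \<Longrightarrow> R \<le> \<bar>p\<bar> \<Longrightarrow> 0 \<le> h s p"
    using coer unfolding coercive_def by blast
  have "compact ({0..1::real} \<times> {-\<bar>R\<bar>..\<bar>R\<bar>})"
    by (intro compact_Times compact_Icc)
  moreover have "continuous_on ({0..1} \<times> {-\<bar>R\<bar>..\<bar>R\<bar>}) (\<lambda>(s, p). h s p)"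
    by (rule continuous_on_subset[OF cont]) auto
  ultimately obtain K where
    K: "\<And>x. x \<in> {0..1} \<times> {-\<bar>R\<bar>..\<bar>R\<bar>} \<Longrightarrow> \<bar>case x of (s, p) \<Rightarrow> h s p\<bar> \<le> K"
    using compact_imp_bounded[OF compact_continuous_image] by (fastforce simp: bounded_iff)
  have "min 0 (- K) \<le> h s p" if "s \<in> {0..1}" for s p
  proof (cases "R \<le> \<bar>p\<bar>")
    case True
    then show ?thesis using R[OF that, of p] by (simp add: min_le_iff_disj)
  next
    case False
    then have "(s, p) \<in> {0..1} \<times> {-\<bar>R\<bar>..\<bar>R\<bar>}"
      using that by auto
    from K[OF this] show ?thesis by (simp add: min_le_iff_disj abs_le_iff)
  qed
  then show ?thesis by blast
qed

lemma eventually_const_subsolution: "\<forall>\<^sub>F c in at_bot. subsolution lam h (\<lambda>_. c)"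
proof -
  have "continuous_on {0..1} (\<lambda>s. (\<lambda>(s, p). h s p) (s, 0))"
    by (rule continuous_on_compose2[OF cont]) (auto intro: continuous_intros)
  then have "continuous_on {0..1} (\<lambda>s. h s 0)"
    by simp
  from compact_imp_bounded[OF compact_continuous_image[OF this compact_Icc]]
  obtain K where K: "\<And>s. s \<in> {0..1} \<Longrightarrow> \<bar>h s 0\<bar> \<le> K"
    by (fastforce simp: bounded_iff)
  have "subsolution lam h (\<lambda>_. c)" if "c \<le> - K / lam" for c
  proof (rule subsolution_const)
    fix s :: real assume "s \<in> {0..1}"
    moreover have "lam * c \<le> - K"
      using that lam_pos by (simp add: field_simps)
    ultimately show "lam * c + h s 0 \<le> 0"
      using K[of s] by linarith
  qed
  then show ?thesis
    unfolding eventually_at_bot_linorder by blast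
qed

text \<open>The slope \<open>\<epsilon>\<close> is the same for all subsolutions above \<open>c\<close>. For them, coercivity bounds the slopes
  of the test functions in terms of \<open>c\<close> only, and the modulus of continuity of \<open>h\<close> on the resulting
  compact set controls the effect of the tilt.\<close>

lemma tilted_subsolution:
  assumes "\<delta> > 0"
  obtains \<epsilon> where "\<epsilon> > 0"
    "\<And>w. subsolution lam h w \<Longrightarrow> (\<And>s. s \<in> {0..1} \<Longrightarrow> c \<le> w s) \<Longrightarrow>
       subsolution lam h (\<lambda>s. w s - \<delta> + \<epsilon> * s)"
proof -
  obtain R where R: "\<And>s p. s \<in> {0..1} \<Longrightarrow> R \<le> \<bar>p\<bar> \<Longrightarrow> - lam * c + 1 \<le> h s p"
    using coer unfolding coercive_def by blast
  \<comment> \<open>The margin \<open>1\<close> keeps the slopes in \<open>K\<close> after a shift by \<open>\<epsilon> \<le> 1\<close>.\<close>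
  define K where "K = {0..1::real} \<times> {-\<bar>R\<bar>-1..\<bar>R\<bar>+1}"
  have "uniformly_continuous_on K (\<lambda>(s, p). h s p)"
  proof (rule compact_uniformly_continuous)
    show "continuous_on K (\<lambda>(s, p). h s p)"
      by (rule continuous_on_subset[OF cont]) (auto simp: K_def)
    show "compact K"
      unfolding K_def by (intro compact_Times compact_Icc)
  qed
  moreover have "0 < lam * \<delta> / 2"
    using assms lam_pos by simp
  ultimately obtain d where d: "d > 0"
    "\<And>x y. x \<in> K \<Longrightarrow> y \<in> K \<Longrightarrow> dist y x < d \<Longrightarrow>
       dist (case y of (s, p) \<Rightarrow> h s p) (case x of (s, p) \<Rightarrow> h s p) < lam * \<delta> / 2"
    unfolding uniformly_continuous_on_def by metis
  \<comment> \<open>Of the gap \<open>lam * \<delta>\<close>, one half pays for the change of \<open>h\<close> and the other for the added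
    term \<open>lam * \<epsilon> * s\<close>.\<close>
  define \<epsilon> where "\<epsilon> = min (d / 2) (min 1 (\<delta> / 2))"
  have \<epsilon>: "\<epsilon> > 0" "\<epsilon> < d" "\<epsilon> \<le> 1" "\<epsilon> \<le> \<delta> / 2"
    using d assms by (auto simp: \<epsilon>_def)
  show ?thesis
  proof (rule that[OF \<epsilon>(1)])
    fix w assume w: "subsolution lam h w" and c: "\<And>s. s \<in> {0..1} \<Longrightarrow> c \<le> w s"
    show "subsolution lam h (\<lambda>s. w s - \<delta> + \<epsilon> * s)"
      unfolding subsolution_def
    proof (intro conjI allI impI)
      show "continuous_on {0..1} (\<lambda>s. w s - \<delta> + \<epsilon> * s)"
        using w by (auto simp: subsolution_def intro!: continuous_intros)
    next
      fix \<phi> \<phi>' :: "real \<Rightarrow> real" and s :: real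
      assume s: "s \<in> {0<..<1}"
        and \<phi>: "\<forall>t\<in>{0<..<1}. (\<phi> has_real_derivative \<phi>' t) (at t)" "continuous_on {0<..<1} \<phi>'"
        and max: "\<forall>\<^sub>F t in at s. w t - \<delta> + \<epsilon> * t - \<phi> t \<le> w s - \<delta> + \<epsilon> * s - \<phi> s"
      have "lam * w s + h s (\<phi>' s - \<epsilon>) \<le> 0"
      proof (rule subsolutionD[OF w s, where \<phi> = "\<lambda>t. \<phi> t - \<epsilon> * t" and \<phi>' = "\<lambda>t. \<phi>' t - \<epsilon>"])
        show "((\<lambda>t. \<phi> t - \<epsilon> * t) has_real_derivative \<phi>' t - \<epsilon>) (at t)" if "t \<in> {0<..<1}" for t
          using that \<phi>(1) by (auto intro!: derivative_eq_intros)
        show "continuous_on {0<..<1} (\<lambda>t. \<phi>' t - \<epsilon>)"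
          using \<phi>(2) by (intro continuous_intros)
        show "\<forall>\<^sub>F t in at s. w t - (\<phi> t - \<epsilon> * t) \<le> w s - (\<phi> s - \<epsilon> * s)"
          using max by eventually_elim linarith
      qed
      moreover have "lam * c \<le> lam * w s"
        using c[of s] s lam_pos by auto
      ultimately have "\<not> R \<le> \<bar>\<phi>' s - \<epsilon>\<bar>"
        using R[of s "\<phi>' s - \<epsilon>"] s by auto
      then have "(s, \<phi>' s - \<epsilon>) \<in> K" "(s, \<phi>' s) \<in> K"
        using s \<epsilon> by (auto simp: K_def)
      then have "\<bar>h s (\<phi>' s) - h s (\<phi>' s - \<epsilon>)\<bar> < lam * \<delta> / 2"
        using d(2)[of "(s, \<phi>' s - \<epsilon>)" "(s, \<phi>' s)"] \<epsilon> by (simp add: dist_Pair_Pair dist_real_def)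
      moreover have "lam * (\<epsilon> * s) \<le> lam * \<delta> / 2"
        unfolding times_divide_eq_right[symmetric] using \<epsilon> s lam_pos mult_mono[of \<epsilon> "\<delta> / 2" s 1] by (intro mult_left_mono) auto
      moreover have "lam * (w s - \<delta> + \<epsilon> * s) = lam * w s - lam * \<delta> + lam * (\<epsilon> * s)"
        by (simp add: algebra_simps)
      ultimately show "lam * (w s - \<delta> + \<epsilon> * s) + h s (\<phi>' s) \<le> 0"
        using \<open>lam * w s + h s (\<phi>' s - \<epsilon>) \<le> 0\<close> by linarith
    qed
  qed
qed

lemma end_values_bdd: "\<exists>B. \<forall>w. subsolution lam h w \<longrightarrow> w 1 \<le> B"
proof -
  obtain m where "\<And>s p. s \<in> {0..1} \<Longrightarrow> m \<le> h s p"
    using bounded_below by blast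
  then have "w 1 \<le> - m / lam" if "subsolution lam h w" for w
    using subsolution_le[OF lam_pos that, of m 1] by auto
  then show ?thesis by blast
qed

lemma le_max_subsol_end:
  assumes "subsolution lam h w" "w 0 \<le> \<alpha>"
  shows "w 1 \<le> max_subsol lam h \<alpha> 1"
proof -
  obtain B where "\<And>v. subsolution lam h v \<Longrightarrow> v 1 \<le> B"
    using end_values_bdd by blast
  then have "bdd_above {v 1 |v. subsolution lam h v \<and> v 0 \<le> \<alpha>}"
    by (intro bdd_aboveI[of _ B]) blast
  then show ?thesis
    unfolding max_subsol_def using assms by (intro cSup_upper) blast
qed

lemma max_subsol_end_le:
  assumes "\<And>w. subsolution lam h w \<Longrightarrow> w 0 \<le> \<alpha> \<Longrightarrow> w 1 \<le> B"
  shows "max_subsol lam h \<alpha> 1 \<le> B"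
  unfolding max_subsol_def
proof (rule cSup_least)
  have "\<forall>\<^sub>F c in at_bot. subsolution lam h (\<lambda>_. c) \<and> c \<le> \<alpha>"
    by (intro eventually_conj eventually_const_subsolution eventually_le_at_bot)
  then obtain c where "subsolution lam h (\<lambda>_. c)" "c \<le> \<alpha>"
    using eventually_happens' trivial_limit_at_bot_linorder by blast
  then show "{w 1 |w. subsolution lam h w \<and> w 0 \<le> \<alpha>} \<noteq> {}"
    by blast
qed (use assms in blast)

text \<open>The strictness rests on the fact that subsolutions may be cut off below by a constant
  subsolution \<open>c \<le> \<alpha>\<close> without leaving the competition for \<open>\<beta>\<close>, so that one tilt serves all of them.\<close>

lemma max_subsol_end:
  assumes "\<alpha> < \<beta>"
  shows "max_subsol lam h \<alpha> 1 \<le> max_subsol lam h \<beta> 1"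
    and "max_subsol lam h \<beta> 1 - max_subsol lam h \<alpha> 1 < \<beta> - \<alpha>"
proof -
  show "max_subsol lam h \<alpha> 1 \<le> max_subsol lam h \<beta> 1"
    using assms by (intro max_subsol_end_le le_max_subsol_end) auto
  have "\<forall>\<^sub>F c in at_bot. subsolution lam h (\<lambda>_. c) \<and> c \<le> \<alpha>"
    by (intro eventually_conj eventually_const_subsolution eventually_le_at_bot)
  then obtain c where c: "subsolution lam h (\<lambda>_. c)" "c \<le> \<alpha>"
    using eventually_happens' trivial_limit_at_bot_linorder by blast
  obtain \<epsilon> where \<epsilon>: "\<epsilon> > 0"
    "\<And>w. subsolution lam h w \<Longrightarrow> (\<And>s. s \<in> {0..1} \<Longrightarrow> c \<le> w s) \<Longrightarrow>
       subsolution lam h (\<lambda>s. w s - (\<beta> - \<alpha>) + \<epsilon> * s)"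
    using tilted_subsolution[of "\<beta> - \<alpha>" c] assms by auto
  have "max_subsol lam h \<beta> 1 \<le> max_subsol lam h \<alpha> 1 + (\<beta> - \<alpha>) - \<epsilon>"
  proof (rule max_subsol_end_le)
    fix w assume w: "subsolution lam h w" "w 0 \<le> \<beta>"
    have "subsolution lam h (\<lambda>s. max (w s) c - (\<beta> - \<alpha>) + \<epsilon> * s)"
      by (rule \<epsilon>(2)[OF subsolution_max[OF w(1) c(1)]]) simp
    from le_max_subsol_end[OF this, of \<alpha>] w(2) c(2) assms
    show "w 1 \<le> max_subsol lam h \<alpha> 1 + (\<beta> - \<alpha>) - \<epsilon>"
      by auto
  qed
  then show "max_subsol lam h \<beta> 1 - max_subsol lam h \<alpha> 1 < \<beta> - \<alpha>"
    using \<epsilon>(1) by linarith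
qed

end

section \<open>Composition along a list and fixed points\<close>

text \<open>In this section \<open>F\<close> stands for \<open>\<rho>\<close>, as a family of real functions indexed by the edges.\<close>

lemma foldl_mono_strictly_nonexpansive:
  fixes F :: "real \<Rightarrow> 'e \<Rightarrow> real"
  assumes F: "\<And>e a b. e \<in> E \<Longrightarrow> a < b \<Longrightarrow> F a e \<le> F b e \<and> F b e - F a e < b - a"
    and "set \<xi> \<subseteq> E" "\<xi> \<noteq> []" "a < b"
  shows "foldl F a \<xi> \<le> foldl F b \<xi> \<and> foldl F b \<xi> - foldl F a \<xi> < b - a"
  using assms(2-)
proof (induction \<xi> rule: rev_induct)
  case (snoc e \<xi>)
  have e: "e \<in> E"
    using snoc.prems by simp
  show ?case
  proof (cases "\<xi> = []")
    case True
    then show ?thesis using F[OF e snoc.prems(3)] by simp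
  next
    case False
    then have IH: "foldl F a \<xi> \<le> foldl F b \<xi>" "foldl F b \<xi> - foldl F a \<xi> < b - a"
      using snoc by auto
    show ?thesis
    proof (cases "foldl F a \<xi> = foldl F b \<xi>")
      case True
      then show ?thesis using snoc.prems by simp
    next
      case False
      then show ?thesis
        using IH F[OF e, of "foldl F a \<xi>" "foldl F b \<xi>"] by auto
    qed
  qed
qed simp

lemma foldl_mono:
  fixes F :: "real \<Rightarrow> 'e \<Rightarrow> real"
  assumes "\<And>e a b. e \<in> E \<Longrightarrow> a \<le> b \<Longrightarrow> F a e \<le> F b e"
    and "set \<xi> \<subseteq> E" "a \<le> b"
  shows "foldl F a \<xi> \<le> foldl F b \<xi>"
  using assms(2,3) by (induction \<xi> arbitrary: a b) (auto simp: assms(1))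

lemma le_foldl:
  fixes F :: "real \<Rightarrow> 'e \<Rightarrow> real"
  assumes mono: "\<And>e a b. e \<in> E \<Longrightarrow> a \<le> b \<Longrightarrow> F a e \<le> F b e"
    and c: "\<And>e. e \<in> E \<Longrightarrow> c \<le> F c e"
    and "set \<xi> \<subseteq> E" "c \<le> a"
  shows "c \<le> foldl F a \<xi>"
  using assms(3,4)
proof (induction \<xi> arbitrary: a)
  case (Cons e \<xi>)
  then have "c \<le> F a e"
    using mono[of e c a] c[of e] by auto
  then show ?case
    using Cons by simp
qed simp

text \<open>The displacement \<open>g a - a\<close> is strictly decreasing, nonnegative at \<open>c\<close> and nonpositive far to the
  right; it is continuous because \<open>g\<close> has Lipschitz constant one.\<close>

lemma ex1_fixpoint:
  fixes g :: "real \<Rightarrow> real"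
  assumes g: "\<And>a b. a < b \<Longrightarrow> g a \<le> g b \<and> g b - g a < b - a"
    and c: "c \<le> g c" and B: "\<And>a. g a \<le> B"
  shows "\<exists>!a. g a = a"
proof (rule ex_ex1I)
  have "\<bar>g a - g b\<bar> \<le> \<bar>a - b\<bar>" for a b
    using g[of a b] g[of b a] by (cases a b rule: linorder_cases) auto
  then have "continuous_on {c..max B c} g"
    unfolding continuous_on_iff dist_real_def by (meson le_less_trans)
  then have "continuous_on {c..max B c} (\<lambda>a. a - g a)"
    by (intro continuous_intros)
  then obtain a where "a - g a = 0"
    using c order_trans[OF B[of "max B c"] max.cobounded1[of B c]] IVT'[of "\<lambda>a. a - g a" c 0 "max B c"]
    by auto
  then have "g a = a" by simp
  then show "\<exists>a. g a = a" ..
next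
  show "a = b" if "g a = a" "g b = b" for a b
    using g[of a b] g[of b a] that by (smt (verit))
qed

section \<open>The discrete equation\<close>

lemma successively_snoc:
  "successively P (xs @ [x]) \<longleftrightarrow> successively P xs \<and> (xs \<noteq> [] \<longrightarrow> P (last xs) x)"
  by (auto simp: successively_append_iff)

theorem theorem6p1:
  fixes \<A> :: "(real \<Rightarrow> real ^ 'n) set"
    and H :: "(real \<Rightarrow> real ^ 'n) \<Rightarrow> real \<Rightarrow> real \<Rightarrow> real"
    and E :: "'e set"
    and \<Psi> :: "'e \<Rightarrow> real \<Rightarrow> real ^ 'n"
    and lam :: real
    and f U :: "real ^ 'n \<Rightarrow> real"
  assumes "network \<A>"
    and "hamiltonians \<A> H"
    and "bij_betw \<Psi> E \<A>"
    and "lam > 0"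
    and "\<And>x. x \<in> vertices \<A> \<Longrightarrow> f x = cycle_inf lam H E \<Psi> x"
    and "\<And>x. x \<in> vertices \<A> \<Longrightarrow> U x = path_inf lam H E \<Psi> f x"
  shows "\<forall>x\<in>vertices \<A>.
           U x = Min ((\<lambda>e. rho lam H \<Psi> (U (orig \<Psi> e)) e) ` {e \<in> E. terminal E \<Psi> e = x})"
proof -
  note [simp] = terminal_eq[OF assms(1,3)]
  let ?\<rho> = "rho lam H \<Psi>"
  let ?\<rho>p = "rho_path lam H \<Psi>"
  let ?\<beta> = "beta lam H \<Psi>"

  have im: "\<Psi> ` E = \<A>" and finE: "finite E"
    using assms(1,3) bij_betw_finite by (auto simp: bij_betw_def network_def)
  have arc: "discounted_arc lam (H (\<Psi> e))" if "e \<in> E" for e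
    using that im assms(2,4) by unfold_locales (auto simp: hamiltonians_def)
  have inv: "inv_edge E \<Psi> e \<in> E" "\<Psi> (inv_edge E \<Psi> e) = reversepath (\<Psi> e)" if "e \<in> E" for e
  proof -
    have "reversepath (\<Psi> e) \<in> \<Psi> ` E"
      using that im assms(1) by (auto simp: network_def)
    then show "inv_edge E \<Psi> e \<in> E" "\<Psi> (inv_edge E \<Psi> e) = reversepath (\<Psi> e)"
      by (auto simp: inv_edge_def inv_into_into f_inv_into_f)
  qed
  have orig_vertex: "orig \<Psi> e \<in> vertices \<A>" and term_vertex: "terminal E \<Psi> e \<in> vertices \<A>"
    if "e \<in> E" for e
    using that im by (auto simp: orig_def vertices_def pathstart_def pathfinish_def)
  have ex_in: "\<exists>e\<in>E. terminal E \<Psi> e = x" if x: "x \<in> vertices \<A>" for x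
  proof -
    obtain e where e: "e \<in> E" "x = \<Psi> e 0 \<or> x = \<Psi> e 1"
      using x by (auto simp: vertices_def pathstart_def pathfinish_def simp flip: im)
    then have "terminal E \<Psi> e = x \<or> terminal E \<Psi> (inv_edge E \<Psi> e) = x"
      using inv[of e] by (auto simp: reversepath_def)
    then show ?thesis using e inv by blast
  qed

  have slow: "?\<rho> a e \<le> ?\<rho> b e \<and> ?\<rho> b e - ?\<rho> a e < b - a" if "e \<in> E" "a < b" for e a b
    using discounted_arc.max_subsol_end[OF arc[OF that(1)] that(2)] by (simp add: rho_def)
  then have mono: "?\<rho> a e \<le> ?\<rho> b e" if "e \<in> E" "a \<le> b" for e a b
    using that by (cases "a = b") auto
  have "\<forall>\<^sub>F c in at_bot. \<forall>e\<in>E. c \<le> ?\<rho> c e"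
  proof (rule eventually_ball_finite[OF finE], rule ballI)
    fix e assume e: "e \<in> E"
    show "\<forall>\<^sub>F c in at_bot. c \<le> ?\<rho> c e"
      using discounted_arc.eventually_const_subsolution[OF arc[OF e]]
      by eventually_elim
        (use discounted_arc.le_max_subsol_end[OF arc[OF e]] in \<open>force simp: rho_def\<close>)
  qed
  then obtain c where c: "\<And>e. e \<in> E \<Longrightarrow> c \<le> ?\<rho> c e"
    using eventually_happens' trivial_limit_at_bot_linorder by blast
  have mono_path: "?\<rho>p a \<xi> \<le> ?\<rho>p b \<xi>" if "set \<xi> \<subseteq> E" "a \<le> b" for a b \<xi>
    unfolding rho_path_def using foldl_mono[OF mono that] .
  have ge_path: "c \<le> ?\<rho>p a \<xi>" if "set \<xi> \<subseteq> E" "c \<le> a" for a \<xi>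
    unfolding rho_path_def using le_foldl[where F = ?\<rho>, OF mono c that] .

  have fixpoint: "?\<rho>p (?\<beta> \<xi>) \<xi> = ?\<beta> \<xi>" "c \<le> ?\<beta> \<xi>" if \<xi>: "is_path E \<Psi> \<xi>" for \<xi>
  proof -
    have E: "set \<xi> \<subseteq> E" "\<xi> \<noteq> []"
      using \<xi> by (auto simp: is_path_def)
    have g: "?\<rho>p a \<xi> \<le> ?\<rho>p b \<xi> \<and> ?\<rho>p b \<xi> - ?\<rho>p a \<xi> < b - a" if "a < b" for a b
      unfolding rho_path_def using foldl_mono_strictly_nonexpansive[OF slow E that] .
    obtain \<xi>' e where snoc: "\<xi> = \<xi>' @ [e]" "e \<in> E"
      using E by (metis append_butlast_last_id last_in_set subsetD)
    obtain B where B: "\<And>w. subsolution lam (H (\<Psi> e)) w \<Longrightarrow> w 1 \<le> B"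
      using discounted_arc.end_values_bdd[OF arc[OF snoc(2)]] by blast
    have "?\<rho>p a \<xi> \<le> B" for a
      unfolding snoc rho_path_snoc unfolding rho_def
      by (rule discounted_arc.max_subsol_end_le[OF arc[OF snoc(2)]]) (rule B)
    then have "\<exists>!a. ?\<rho>p a \<xi> = a"
      using g ge_path[OF E(1) order_refl] by (intro ex1_fixpoint[of "\<lambda>a. ?\<rho>p a \<xi>"]) auto
    then show fx: "?\<rho>p (?\<beta> \<xi>) \<xi> = ?\<beta> \<xi>"
      unfolding beta_def by (rule theI')
    show "c \<le> ?\<beta> \<xi>"
    proof (rule ccontr)
      assume "\<not> c \<le> ?\<beta> \<xi>"
      then show False
        using g[of "?\<beta> \<xi>" c] fx ge_path[OF E(1) order_refl] by auto
    qed
  qed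

  have path_ends: "path_orig \<Psi> \<xi> \<in> vertices \<A>" "path_term E \<Psi> \<xi> \<in> vertices \<A>"
    if "is_path E \<Psi> \<xi>" for \<xi>
    unfolding path_orig_def path_term_def
    using that by (auto simp: is_path_def simp del: terminal_eq[OF assms(1,3)]
      intro!: orig_vertex term_vertex)
  have f_le: "f (path_orig \<Psi> \<xi>) \<le> ?\<beta> \<xi>" if "is_cycle E \<Psi> \<xi>" for \<xi>
  proof -
    have "path_orig \<Psi> \<xi> \<in> vertices \<A>"
      using that path_ends by (auto simp: is_cycle_def)
    then show ?thesis
      unfolding assms(5)[OF \<open>path_orig \<Psi> \<xi> \<in> vertices \<A>\<close>] cycle_inf_def
      using that fixpoint(2)
      by (intro cInf_lower bdd_belowI[of _ c]) (auto simp: is_cycle_def)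
  qed
  have f_greatest: "b \<le> f x"
    if x: "x \<in> vertices \<A>" and
      b: "\<And>\<xi>. is_cycle E \<Psi> \<xi> \<Longrightarrow> path_orig \<Psi> \<xi> = x \<Longrightarrow> b \<le> ?\<beta> \<xi>" for b x
    unfolding assms(5)[OF x] cycle_inf_def
  proof (rule cInf_greatest)
    \<comment> \<open>An edge into \<open>x\<close>, preceded by its inverse, is a cycle based on \<open>x\<close>.\<close>
    obtain e where e: "e \<in> E" "terminal E \<Psi> e = x"
      using ex_in[OF x] by blast
    then have "is_cycle E \<Psi> [inv_edge E \<Psi> e, e]" "path_orig \<Psi> [inv_edge E \<Psi> e, e] = x"
      using inv[OF e(1)]
      by (auto simp: is_cycle_def is_path_def path_orig_def path_term_def orig_def reversepath_def)
    then show "{?\<beta> \<xi> |\<xi>. is_cycle E \<Psi> \<xi> \<and> path_orig \<Psi> \<xi> = x} \<noteq> {}"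
      by blast
  qed (use b in blast)
  have f_ge: "c \<le> f x" if "x \<in> vertices \<A>" for x
    using f_greatest[OF that] fixpoint(2) by (auto simp: is_cycle_def)

  let ?vals = "\<lambda>x. {?\<rho>p (f (path_orig \<Psi> \<xi>)) \<xi> |\<xi>. is_path E \<Psi> \<xi> \<and> path_term E \<Psi> \<xi> = x}"
  have vals_ne: "?vals x \<noteq> {}" if x: "x \<in> vertices \<A>" for x
  proof -
    obtain e where "e \<in> E" "terminal E \<Psi> e = x"
      using ex_in[OF x] by blast
    then have "is_path E \<Psi> [e]" "path_term E \<Psi> [e] = x"
      by (auto simp: is_path_def path_term_def)
    then show ?thesis by blast
  qed
  have vals_ge: "c \<le> v" if "v \<in> ?vals x" for v x
    using that path_ends(1) by (auto simp: is_path_def intro!: ge_path f_ge)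
  have U_eq: "U x = Inf (?vals x)" if "x \<in> vertices \<A>" for x
    using assms(6)[OF that] by (simp add: path_inf_def)
  have U_le: "U (path_term E \<Psi> \<xi>) \<le> ?\<rho>p (f (path_orig \<Psi> \<xi>)) \<xi>" if "is_path E \<Psi> \<xi>" for \<xi>
    unfolding U_eq[OF path_ends(2)[OF that]]
    using that by (intro cInf_lower bdd_belowI[OF vals_ge]) blast+

  have U_le_f: "U y \<le> f y" if y: "y \<in> vertices \<A>" for y
  proof (rule f_greatest[OF y])
    fix \<xi> assume \<xi>: "is_cycle E \<Psi> \<xi>" "path_orig \<Psi> \<xi> = y"
    then have p: "is_path E \<Psi> \<xi>" "path_term E \<Psi> \<xi> = y"
      by (auto simp: is_cycle_def)
    have "U y \<le> ?\<rho>p (f y) \<xi>"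
      using U_le[OF p(1)] p(2) \<xi>(2) by simp
    also have "\<dots> \<le> ?\<rho>p (?\<beta> \<xi>) \<xi>"
      using p(1) f_le[OF \<xi>(1)] \<xi>(2) by (intro mono_path) (auto simp: is_path_def)
    also have "\<dots> = ?\<beta> \<xi>"
      by (rule fixpoint(1)[OF p(1)])
    finally show "U y \<le> ?\<beta> \<xi>" .
  qed

  have upper: "U (terminal E \<Psi> e) \<le> ?\<rho> (U (orig \<Psi> e)) e" if e: "e \<in> E" for e
  proof (rule field_le_epsilon)
    fix \<eta> :: real assume "\<eta> > 0"
    then have "Inf (?vals (orig \<Psi> e)) < U (orig \<Psi> e) + \<eta>"
      using U_eq[OF orig_vertex[OF e]] by simp
    then obtain \<xi> where \<xi>: "is_path E \<Psi> \<xi>" "path_term E \<Psi> \<xi> = orig \<Psi> e"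
      and less: "?\<rho>p (f (path_orig \<Psi> \<xi>)) \<xi> < U (orig \<Psi> e) + \<eta>"
      using cInf_lessD[OF vals_ne[OF orig_vertex[OF e]]] by blast
    have p: "is_path E \<Psi> (\<xi> @ [e])" "path_orig \<Psi> (\<xi> @ [e]) = path_orig \<Psi> \<xi>"
      "path_term E \<Psi> (\<xi> @ [e]) = terminal E \<Psi> e"
      using \<xi> e unfolding is_path_def path_orig_def path_term_def by (auto simp: successively_snoc)
    have "U (terminal E \<Psi> e) \<le> ?\<rho>p (f (path_orig \<Psi> \<xi>)) (\<xi> @ [e])"
      using U_le[OF p(1)] unfolding p(2,3) .
    also have "\<dots> \<le> ?\<rho> (U (orig \<Psi> e) + \<eta>) e"
      unfolding rho_path_snoc using e less by (intro mono) auto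
    also have "\<dots> \<le> ?\<rho> (U (orig \<Psi> e)) e + \<eta>"
      using slow[OF e, of "U (orig \<Psi> e)" "U (orig \<Psi> e) + \<eta>"] \<open>\<eta> > 0\<close> by auto
    finally show "U (terminal E \<Psi> e) \<le> ?\<rho> (U (orig \<Psi> e)) e + \<eta>" .
  qed

  have lower: "\<exists>e\<in>E. terminal E \<Psi> e = path_term E \<Psi> \<xi> \<and>
      ?\<rho> (U (orig \<Psi> e)) e \<le> ?\<rho>p (f (path_orig \<Psi> \<xi>)) \<xi>" if \<xi>: "is_path E \<Psi> \<xi>" for \<xi>
  proof -
    obtain \<xi>' e where snoc: "\<xi> = \<xi>' @ [e]"
      using \<xi> by (metis is_path_def append_butlast_last_id)
    have e: "e \<in> E"
      using \<xi> by (auto simp: snoc is_path_def)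
    have "U (orig \<Psi> e) \<le> ?\<rho>p (f (path_orig \<Psi> \<xi>)) \<xi>'"
    proof (cases "\<xi>' = []")
      case True
      then show ?thesis
        using U_le_f[OF orig_vertex[OF e]] by (simp add: snoc path_orig_def rho_path_def)
    next
      case False
      then have "is_path E \<Psi> \<xi>'" "path_orig \<Psi> \<xi>' = path_orig \<Psi> \<xi>"
        "path_term E \<Psi> \<xi>' = orig \<Psi> e"
        using \<xi> unfolding snoc is_path_def path_orig_def path_term_def
        by (auto simp: successively_snoc)
      then show ?thesis
        using U_le[of \<xi>'] by simp
    qed
    then have "?\<rho> (U (orig \<Psi> e)) e \<le> ?\<rho>p (f (path_orig \<Psi> \<xi>)) \<xi>"
      unfolding snoc rho_path_snoc by (rule mono[OF e])
    then show ?thesis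
      using e by (auto simp: snoc path_term_def)
  qed

  show ?thesis
  proof
    fix x assume x: "x \<in> vertices \<A>"
    let ?S = "(\<lambda>e. ?\<rho> (U (orig \<Psi> e)) e) ` {e \<in> E. terminal E \<Psi> e = x}"
    have fin: "finite ?S"
      using finE by simp
    have ne: "?S \<noteq> {}"
      using ex_in[OF x] by blast
    show "U x = Min ?S"
    proof (rule antisym)
      show "U x \<le> Min ?S"
        unfolding Min_ge_iff[OF fin ne] using upper by blast
      show "Min ?S \<le> U x"
        unfolding U_eq[OF x]
      proof (rule cInf_greatest[OF vals_ne[OF x]])
        fix v assume "v \<in> ?vals x"
        then obtain \<xi> where \<xi>: "is_path E \<Psi> \<xi>" "path_term E \<Psi> \<xi> = x"
          and v: "v = ?\<rho>p (f (path_orig \<Psi> \<xi>)) \<xi>"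
          by blast
        from lower[OF \<xi>(1)] obtain e where "e \<in> E" "terminal E \<Psi> e = x"
          and le: "?\<rho> (U (orig \<Psi> e)) e \<le> v"
          using \<xi>(2) v by blast
        then have "Min ?S \<le> ?\<rho> (U (orig \<Psi> e)) e"
          using fin by (intro Min_le) blast+
        with le show "Min ?S \<le> v" by linarith
      qed
    qed
  qed
qed

end
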